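(* Let $S$ be a finite set of integers and let $\omega \in S^{\mathbb{N}}$. The following are equivalent. (i) The word $\omega$ has bounded abelian complexity; (ii) For all finite $T \subset \mathbb{Z}$, every non-erasing morphism $\phi: S^\infty \to T^\infty$ anchors $\omega$.
   Context: $\mathbb{N}$ denotes the positive integers. Alphabets are finite sets of integers. $S^*$ is the set of finite words over $S$ (including the empty word), $S^{\mathbb{N}}$ the set of infinite words $x_1x_2x_3\cdots$ with $x_i\in S$, and $S^\infty = S^*\cup S^{\mathbb{N}}$. The nonempty factors of an infinite word $\omega = x_1x_2\cdots$ are the finite words $x_m x_{m+1}\cdots x_n$, $m\le n$; $\mathcal{F}^n(\omega)$ is the set of factors of length $n$. $|B|$ is the length of a finite word $B$, and $\sum B$ is the sum of its letters. $\omega$ has bounded additive complexity if there is $M\in\mathbb{N}$ such that $|\{\sum B : B\in\mathcal{F}^n(\omega)\}|\le M$ for every $n\in\mathbb{N}$. The abelian complexity of $\omega$ is the function sending $n\in\mathbb{N}$ to the maximum number of distinct elements of $\mathcal{F}^n(\omega)$, no two of which are permutations of each other; it is bounded if some $M\in\mathbb{N}$ bounds its values for all $n\in\mathbb{N}$. A morphism $\phi: S^\infty\to T^\infty$ satisfies $\phi(BB') = \phi(B)\phi(B')$ for all $B\in S^*$, $B'\in S^\infty$; it is determined by the finite words $\phi(s)\in T^*$, $s \in S$, via $\phi(x_1x_2\cdots) = \phi(x_1)\phi(x_2)\cdots$ (for finite and infinite words). It is non-erasing if no nonempty word is mapped to the empty word. A non-erasing morphism $\phi$ anchors $\omega\in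 S^{\mathbb{N}}$ if $\phi(\omega)\in T^{\mathbb{N}}$ has bounded additive complexity. *)

theory Defs
  imports "HOL-Combinatorics.List_Permutation" "HOL-Library.Stream"
begin

datatype 'a ext_word = FinW "'a list" | InfW "'a stream"

definition ext_words :: "'a set \<Rightarrow> 'a ext_word set" where
  "ext_words S = FinW ` lists S \<union> InfW ` streams S"

text \<open>
  Concatenation is only meaningful when the first argument is finite; the third equation is a
  totalisation that is never reached in the definition of morphisms below.
\<close>

fun conc :: "'a ext_word \<Rightarrow> 'a ext_word \<Rightarrow> 'a ext_word" (infixr \<open>\<cdot>\<close> 65) where
  "FinW u \<cdot> FinW v = FinW (u @ v)"
| "FinW u \<cdot> InfW s = InfW (u @- s)"
| "InfW s \<cdot> w = InfW s"

text \<open>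
  Finite words are required to have finite images: otherwise the product on the right-hand side of
  the morphism equation would not make sense. For non-erasing morphisms the infinite product
  formula is a consequence (\<open>morphism_InfW\<close> below), and every choice of
  nonempty images of the letters is realised (\<open>morphism_exists\<close>).
\<close>

definition morphism :: "'a set \<Rightarrow> 'b set \<Rightarrow> ('a ext_word \<Rightarrow> 'b ext_word) \<Rightarrow> bool" where
  "morphism S T \<phi> \<longleftrightarrow>
     \<phi> ` ext_words S \<subseteq> ext_words T \<and>
     \<phi> ` FinW ` lists S \<subseteq> FinW ` lists T \<and>
     (\<forall>B\<in>lists S. \<forall>B'\<in>ext_words S. \<phi> (FinW B \<cdot> B') = \<phi> (FinW B) \<cdot> \<phi> B')"

definition non_erasing :: "'a set \<Rightarrow> ('a ext_word \<Rightarrow> 'b ext_word) \<Rightarrow> bool" where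
  "non_erasing S \<phi> \<longleftrightarrow> (\<forall>w\<in>ext_words S. w \<noteq> FinW [] \<longrightarrow> \<phi> w \<noteq> FinW [])"

definition factors :: "nat \<Rightarrow> 'a stream \<Rightarrow> 'a list set" where
  "factors n \<omega> = {stake n (sdrop m \<omega>) | m. True}"

text \<open>
  The maximum is over a finite set when the letters of \<open>\<omega>\<close> come from a finite
  alphabet, the only case in which this is used.
\<close>

definition abelian_complexity :: "'a stream \<Rightarrow> nat \<Rightarrow> nat" where
  "abelian_complexity \<omega> n =
     Max {card A | A. A \<subseteq> factors n \<omega> \<and> pairwise (\<lambda>u v. \<not> u <~~> v) A}"

definition bounded_abelian_complexity :: "'a stream \<Rightarrow> bool" where
  "bounded_abelian_complexity \<omega> \<longleftrightarrow> (\<exists>M\<ge>1. \<forall>n\<ge>1. abelian_complexity \<omega> n \<le> M)"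

definition bounded_additive_complexity :: "int stream \<Rightarrow> bool" where
  "bounded_additive_complexity \<omega> \<longleftrightarrow>
     (\<exists>M\<ge>1. \<forall>n\<ge>1. finite (sum_list ` factors n \<omega>) \<and> card (sum_list ` factors n \<omega>) \<le> M)"

definition anchors :: "int set \<Rightarrow> (int ext_word \<Rightarrow> int ext_word) \<Rightarrow> int stream \<Rightarrow> bool" where
  "anchors T \<phi> \<omega> \<longleftrightarrow>
     (\<exists>\<omega>'\<in>streams T. \<phi> (InfW \<omega>) = InfW \<omega>' \<and> bounded_additive_complexity \<omega>')"

lemma morphism_InfW:
  assumes mor: "morphism S T \<phi>" and ne: "non_erasing S \<phi>" and \<omega>: "\<omega> \<in> streams S"
    and f: "\<And>x. x \<in> S \<Longrightarrow> \<phi> (FinW [x]) = FinW (f x)"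
  shows "\<phi> (InfW \<omega>) = InfW (flat (smap f \<omega>))"
proof -
  have fne: "f x \<noteq> []" if "x \<in> S" for x
    using ne that f[OF that] by (force simp: non_erasing_def ext_words_def)
  have step: "\<phi> (InfW s) = FinW (f (shd s)) \<cdot> \<phi> (InfW (stl s))" if s: "s \<in> streams S" for s
  proof -
    have "shd s \<in> S" "stl s \<in> streams S"
      using s by (auto intro: streams_shd streams_stl)
    then have "[shd s] \<in> lists S" "InfW (stl s) \<in> ext_words S"
      by (simp_all add: ext_words_def)
    then have "\<phi> (FinW [shd s] \<cdot> InfW (stl s)) = \<phi> (FinW [shd s]) \<cdot> \<phi> (InfW (stl s))"
      using mor unfolding morphism_def by blast
    then show ?thesis by (simp add: f[OF \<open>shd s \<in> S\<close>])
  qed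
  have not_fin: "\<phi> (InfW s) \<noteq> FinW u" if "s \<in> streams S" for s u
    using that
  proof (induction "length u" arbitrary: s u rule: less_induct)
    case less
    have S: "shd s \<in> S" "stl s \<in> streams S"
      using less.prems by (auto intro: streams_shd streams_stl)
    show ?case
    proof
      assume "\<phi> (InfW s) = FinW u"
      with step[OF less.prems] obtain v where v: "\<phi> (InfW (stl s)) = FinW v" "u = f (shd s) @ v"
        by (cases "\<phi> (InfW (stl s))") auto
      then have "length v < length u" using fne[OF S(1)] by simp
      from less.hyps[OF this S(2)] v(1) show False by simp
    qed
  qed
  define g where "g s = (THE t. \<phi> (InfW s) = InfW t)" for s
  have g: "\<phi> (InfW s) = InfW (g s)" if "s \<in> streams S" for s
    using not_fin[OF that] unfolding g_def by (cases "\<phi> (InfW s)") auto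
  have gstep: "g s = f (shd s) @- g (stl s)" if "s \<in> streams S" for s
    using step[OF that] g[OF that] g[OF streams_stl[OF that]] by simp
  have "g s !! n = flat (smap f s) !! n" if "s \<in> streams S" for s n
    using that
  proof (induction n arbitrary: s rule: less_induct)
    case (less n)
    have S: "shd s \<in> S" "stl s \<in> streams S"
      using less.prems by (auto intro: streams_shd streams_stl)
    have "flat (smap f s) = f (shd s) @- flat (smap f (stl s))"
      using fne[OF S(1)] by (subst flat_unfold) auto
    moreover have "n - length (f (shd s)) < n" if "\<not> n < length (f (shd s))"
      using fne[OF S(1)] that by (cases "f (shd s)") auto
    ultimately show ?case
      using gstep[OF less.prems] less.IH[OF _ S(2), of "n - length (f (shd s))"]
      by (cases "n < length (f (shd s))") (simp_all add: shift_snth)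
  qed
  then have "snth (g \<omega>) = snth (flat (smap f \<omega>))"
    using \<omega> by blast
  then have "g \<omega> = flat (smap f \<omega>)"
    by (metis stream_smap_nats)
  then show ?thesis using g[OF \<omega>] by simp
qed

lemma morphism_exists:
  assumes f: "\<And>x. x \<in> S \<Longrightarrow> f x \<in> lists T \<and> f x \<noteq> []"
  shows "\<exists>\<phi>. morphism S T \<phi> \<and> non_erasing S \<phi> \<and> (\<forall>x\<in>S. \<phi> (FinW [x]) = FinW (f x))"
proof -
  define \<phi> where
    "\<phi> = case_ext_word (\<lambda>u. FinW (concat (map f u))) (\<lambda>s. InfW (flat (smap f s)))"
  have fin: "concat (map f u) \<in> lists T" if "u \<in> lists S" for u
    using that f by (induction u) auto
  have inf: "flat (smap f s) \<in> streams T" if s: "s \<in> streams S" for s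
  proof -
    have "\<forall>xs\<in>sset (smap f s). xs \<noteq> [] \<and> set xs \<subseteq> T"
      using s f by (fastforce simp: stream.set_map streams_iff_sset)
    then show ?thesis by (auto simp: streams_iff_sset)
  qed
  have shift: "flat (smap f (u @- s)) = concat (map f u) @- flat (smap f s)" if "u \<in> lists S" for u s
    using that f by (induction u) auto
  have "morphism S T \<phi>"
    unfolding morphism_def
  proof (intro conjI ballI)
    have "\<phi> w \<in> ext_words T" if "w \<in> ext_words S" for w
      using that fin inf by (cases w) (simp_all add: \<phi>_def ext_words_def image_iff)
    then show "\<phi> ` ext_words S \<subseteq> ext_words T" by (rule image_subsetI)
    have "\<phi> (FinW u) \<in> FinW ` lists T" if "u \<in> lists S" for u
      using fin[OF that] by (simp add: \<phi>_def)
    then show "\<phi> ` FinW ` lists S \<subseteq> FinW ` lists T"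
      by (blast intro: image_subsetI)
    fix B B' assume "B \<in> lists S"
    then show "\<phi> (FinW B \<cdot> B') = \<phi> (FinW B) \<cdot> \<phi> B'"
      using shift unfolding \<phi>_def by (cases B') (simp_all del: smap_shift)
  qed
  moreover have "non_erasing S \<phi>"
    unfolding non_erasing_def
  proof (intro ballI impI)
    fix w assume "w \<in> ext_words S" "w \<noteq> FinW []"
    then show "\<phi> w \<noteq> FinW []"
      using f by (cases w; cases "case w of FinW u \<Rightarrow> u | _ \<Rightarrow> []")
        (auto simp: \<phi>_def ext_words_def)
  qed
  ultimately show ?thesis by (intro exI[of _ \<phi>]) (auto simp: \<phi>_def)
qed

end

theory Submission
  imports Defs
begin

text \<open>
  Both conditions are equivalent to balancedness: for each letter \<open>a\<close>, the number of
  occurrences of \<open>a\<close> varies by a bounded amount over the factors of a common length.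
  As the window of length \<open>n\<close> slides by one position, this number changes by at most
  one, so it takes all intermediate values; hence a bound on the number of its values bounds its
  variation. This extracts balancedness from bounded abelian complexity, and also from bounded
  additive complexity of the image under the morphism \<open>a \<mapsto> 1\<close>, \<open>b \<mapsto> 0\<close>
  for \<open>b \<noteq> a\<close>. Conversely, if \<open>\<omega>\<close> is balanced, then any additive weight of the letters
  varies boundedly over factors of the same length. Cutting factors of \<open>\<phi>(\<omega>)\<close> at
  boundaries of images of letters, two factors of equal length come, up to bounded errors, from
  factors of \<open>\<omega>\<close> whose images have nearly equal length, and balancedness applied
  to the weights \<open>|\<phi>(x)|\<close> and \<open>\<Sum>\<phi>(x)\<close> bounds the difference of their sums.
\<close>

definition balanced :: "int \<Rightarrow> 'a stream \<Rightarrow> bool" where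
  "balanced C \<omega> \<longleftrightarrow> (\<forall>a n i j.
     \<bar>int (count_list (stake n (sdrop i \<omega>)) a) - int (count_list (stake n (sdrop j \<omega>)) a)\<bar> \<le> C)"

section \<open>Factors and abelian complexity\<close>

lemma factors_eq_range: "factors n \<omega> = range (\<lambda>m. stake n (sdrop m \<omega>))"
  by (auto simp: factors_def)

lemma factors_subset_lists:
  assumes "\<omega> \<in> streams S"
  shows "factors n \<omega> \<subseteq> {xs. set xs \<subseteq> S \<and> length xs = n}"
proof -
  have "set (stake n (sdrop m \<omega>)) \<subseteq> S" for m
    using assms by (auto simp: in_set_conv_nth sdrop_snth streams_iff_snth)
  then show ?thesis by (auto simp: factors_def)
qed

lemma finite_factors: "finite S \<Longrightarrow> \<omega> \<in> streams S \<Longrightarrow> finite (factors n \<omega>)"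
  using factors_subset_lists finite_lists_length_eq finite_subset by metis

text \<open>No two distinct words of a set are permutations of each other exactly when
  \<open>mset\<close> is injective on it. Hence such a set has at most as many elements as there are
  multisets, and a set of representatives attains this bound.\<close>

lemma abelian_complexity_eq_card_mset:
  assumes fin: "finite (factors n \<omega>)"
  shows "abelian_complexity \<omega> n = card (mset ` factors n \<omega>)"
  unfolding abelian_complexity_def
proof (rule Max_eqI)
  let ?K = "{card A | A. A \<subseteq> factors n \<omega> \<and> pairwise (\<lambda>u v. \<not> u <~~> v) A}"
  have "?K \<subseteq> card ` Pow (factors n \<omega>)" by auto
  then show "finite ?K" using fin by (meson finite_Pow_iff finite_imageI finite_subset)
  show "k \<le> card (mset ` factors n \<omega>)" if "k \<in> ?K" for k
  proof -
    from that obtain A where A: "k = card A" "A \<subseteq> factors n \<omega>"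
      "pairwise (\<lambda>u v. \<not> u <~~> v) A" by auto
    then have "inj_on mset A" by (auto simp: pairwise_def inj_on_def)
    then have "k = card (mset ` A)" using A by (simp add: card_image)
    also have "\<dots> \<le> card (mset ` factors n \<omega>)"
      using A fin by (intro card_mono) auto
    finally show ?thesis .
  qed
  \<comment> \<open>\<open>A\<close> picks one factor from each permutation class.\<close>
  obtain A where A: "A \<subseteq> factors n \<omega>" "inj_on mset A" "mset ` factors n \<omega> = mset ` A"
    using subset_image_inj[of "mset ` factors n \<omega>" mset "factors n \<omega>"] by auto
  then have "pairwise (\<lambda>u v. \<not> u <~~> v) A" by (auto simp: pairwise_def inj_on_def)
  with A show "card (mset ` factors n \<omega>) \<in> ?K"
    by (auto simp: card_image intro!: exI[of _ A])
qed

text \<open>Factor sums become differences of prefix sums, the shape in which \<open>P\<close> and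
  \<open>Q\<close> enter \<open>subsampled_increments_diff_le\<close>.\<close>

lemma sum_list_factor:
  fixes f :: "'a \<Rightarrow> int"
  shows "sum_list (map f (stake n (sdrop m \<omega>))) =
    sum_list (map f (stake (m + n) \<omega>)) - sum_list (map f (stake m \<omega>))"
  by (simp only: stake_add[symmetric] map_append sum_list_append add_diff_cancel_left')

section \<open>Sliding windows and intermediate values\<close>

lemma count_list_factor_Suc:
  "\<bar>int (count_list (stake n (sdrop (Suc m) \<omega>)) a) - int (count_list (stake n (sdrop m \<omega>)) a)\<bar> \<le> 1"
proof -
  \<comment> \<open>The factor of length \<open>n + 1\<close> at \<open>m\<close>, split once at its
    last and once at its first letter.\<close>
  have "stake n (sdrop m \<omega>) @ [\<omega> !! (m + n)] = (\<omega> !! m) # stake n (sdrop (Suc m) \<omega>)"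
    using stake_Suc[of n "sdrop m \<omega>", symmetric] by (simp add: sdrop_snth)
  from arg_cong[OF this, of "\<lambda>u. count_list u a"] show ?thesis
    by (simp del: sdrop.simps split: if_splits)
qed

text \<open>By the discrete intermediate value theorem, the range contains every integer between
  \<open>g i\<close> and \<open>g j\<close>.\<close>

lemma unit_steps_diff_le_card_range:
  fixes g :: "nat \<Rightarrow> int"
  assumes step: "\<And>i. \<bar>g (Suc i) - g i\<bar> \<le> 1" and fin: "finite (range g)"
  shows "\<bar>g i - g j\<bar> \<le> int (card (range g))"
proof -
  have up: "{min (g i) (g j)..max (g i) (g j)} \<subseteq> range g" if "i \<le> j" for i j
  proof
    fix k assume k: "k \<in> {min (g i) (g j)..max (g i) (g j)}"
    show "k \<in> range g"
    proof (cases "g i \<le> g j")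
      case True
      then show ?thesis using nat_intermed_int_val[of i j g k] step that k by auto
    next
      case False
      \<comment> \<open>A descent of \<open>g\<close> is treated as an ascent of
        \<open>- g\<close>.\<close>
      then have "\<exists>l. i \<le> l \<and> l \<le> j \<and> - g l = - k"
        using step that k by (intro nat_intermed_int_val) (auto simp: abs_minus_commute)
      then show ?thesis by auto
    qed
  qed
  have "\<bar>g i - g j\<bar> \<le> int (card (range g))" if "i \<le> j" for i j
    using card_mono[OF fin up[OF that]] by simp
  then show ?thesis by (metis abs_minus_commute nat_le_linear)
qed

lemma count_diff_le_if_card_count_le:
  assumes "\<And>n. n \<ge> 1 \<Longrightarrow> finite ((\<lambda>u. int (count_list u a)) ` factors n \<omega>) \<and>
      card ((\<lambda>u. int (count_list u a)) ` factors n \<omega>) \<le> M"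
  shows "\<bar>int (count_list (stake n (sdrop i \<omega>)) a) - int (count_list (stake n (sdrop j \<omega>)) a)\<bar> \<le> int M"
\<comment> \<open>The hypothesis covers only \<open>n \<ge> 1\<close>; for \<open>n = 0\<close> both
  counts vanish.\<close>
proof (cases n)
  case (Suc k)
  let ?g = "\<lambda>m. int (count_list (stake n (sdrop m \<omega>)) a)"
  have fin: "finite (range ?g)" and M: "card (range ?g) \<le> M"
    using assms[of n] Suc by (simp_all add: factors_eq_range image_image)
  have "\<bar>?g i - ?g j\<bar> \<le> int (card (range ?g))"
    by (rule unit_steps_diff_le_card_range[OF count_list_factor_Suc fin])
  then show ?thesis using M by linarith
qed simp

section \<open>Balancedness and bounded abelian complexity\<close>

lemma bounded_abelian_complexity_imp_balanced:
  assumes "finite S" "\<omega> \<in> streams S" "bounded_abelian_complexity \<omega>"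
  obtains C where "balanced C \<omega>"
proof -
  obtain M where M: "\<And>n. n \<ge> 1 \<Longrightarrow> abelian_complexity \<omega> n \<le> M"
    using assms(3) by (auto simp: bounded_abelian_complexity_def)
  have "balanced (int M) \<omega>"
    unfolding balanced_def
  proof (intro allI count_diff_le_if_card_count_le conjI)
    fix a n assume n: "(n::nat) \<ge> 1"
    have fin: "finite (factors n \<omega>)" using finite_factors assms by blast
    let ?c = "(\<lambda>u. int (count_list u a)) ` factors n \<omega>"
    show "finite ?c" using fin by simp
    \<comment> \<open>The count depends only on the multiset of letters, so it takes at most as many
      values as there are multisets.\<close>
    have "?c = (\<lambda>X. int (count X a)) ` mset ` factors n \<omega>"
      by (simp add: image_image count_mset)
    then have "card ?c \<le> card (mset ` factors n \<omega>)"
      using fin by (simp add: card_image_le)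
    then show "card ?c \<le> M"
      using M[OF n] abelian_complexity_eq_card_mset[OF fin] by simp
  qed
  then show ?thesis by (rule that)
qed

text \<open>A multiset over \<open>S\<close> is determined by its vector of counts, and balancedness
  confines each coordinate to the \<open>2 * C + 1\<close> integers around the count in the prefix
  of length \<open>n\<close>.\<close>

lemma balanced_imp_bounded_abelian_complexity:
  assumes S: "finite S" "\<omega> \<in> streams S" and bal: "balanced C \<omega>"
  shows "bounded_abelian_complexity \<omega>"
proof -
  have "abelian_complexity \<omega> n \<le> nat (2 * C + 1) ^ card S" for n
  proof -
    have fin: "finite (factors n \<omega>)" using finite_factors S by blast
    define c where "c a = int (count_list (stake n (sdrop 0 \<omega>)) a)" for a
    let ?I = "PiE S (\<lambda>a. {c a - C..c a + C})"
    let ?v = "\<lambda>X. restrict (\<lambda>a. int (count X a)) S"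
    have "inj_on ?v (mset ` factors n \<omega>)"
    proof (rule inj_onI)
      fix X Y assume XY: "X \<in> mset ` factors n \<omega>" "Y \<in> mset ` factors n \<omega>" "?v X = ?v Y"
      have "set_mset Z \<subseteq> S" if "Z \<in> mset ` factors n \<omega>" for Z
        using that subsetD[OF factors_subset_lists[OF S(2)]] by (elim imageE) simp
      with XY have sub: "set_mset X \<subseteq> S" "set_mset Y \<subseteq> S" by blast+
      show "X = Y"
      proof (rule multiset_eqI)
        fix a
        show "count X a = count Y a"
        proof (cases "a \<in> S")
          case True
          then show ?thesis using fun_cong[OF XY(3), of a] by simp
        next
          case False
          then have "a \<notin># X" "a \<notin># Y" using sub by auto
          then show ?thesis by (simp add: not_in_iff)
        qed
      qed
    qed
    moreover have "?v ` mset ` factors n \<omega> \<subseteq> ?I"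
    proof -
      have "c a - C \<le> int (count_list (stake n (sdrop m \<omega>)) a) \<and>
          int (count_list (stake n (sdrop m \<omega>)) a) \<le> c a + C" for a m
        using bal[unfolded balanced_def, rule_format, of n m a 0] by (simp only: c_def) linarith
      then show ?thesis by (auto simp: factors_def count_mset)
    qed
    ultimately have "card (mset ` factors n \<omega>) \<le> card ?I"
      using S(1) by (intro card_inj_on_le finite_PiE) auto
    also have "\<dots> = nat (2 * C + 1) ^ card S"
      using S(1) by (simp add: card_PiE)
    finally show ?thesis using abelian_complexity_eq_card_mset[OF fin] by simp
  qed
  then show ?thesis unfolding bounded_abelian_complexity_def
    \<comment> \<open>The definition asks for a bound of at least 1, hence the
      \<open>max\<close>.\<close>
    by (intro exI[of _ "max 1 (nat (2 * C + 1) ^ card S)"]) (simp add: le_max_iff_disj)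
qed

section \<open>Additive weights on balanced words\<close>

lemma sum_list_map_eq_sum_count_list:
  fixes f :: "'a \<Rightarrow> int"
  assumes "finite S" "set xs \<subseteq> S"
  shows "sum_list (map f xs) = (\<Sum>a\<in>S. int (count_list xs a) * f a)"
  using assms(2)
proof (induction xs)
  case (Cons x xs)
  have "(\<Sum>a\<in>S. int (count_list (x # xs) a) * f a) =
      (\<Sum>a\<in>S. (if x = a then f a else 0) + int (count_list xs a) * f a)"
    by (rule sum.cong) (auto simp: distrib_right)
  with Cons show ?case using assms(1) by (simp add: sum.distrib)
qed simp

text \<open>The weight is a linear combination of letter counts, so each letter \<open>a\<close>
  contributes at most \<open>C * \<bar>f a\<bar>\<close> to the difference.\<close>

lemma balanced_weight_diff_le:
  fixes f :: "'a \<Rightarrow> int"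
  assumes S: "finite S" "\<omega> \<in> streams S" and bal: "balanced C \<omega>"
  shows "\<bar>sum_list (map f (stake n (sdrop i \<omega>))) - sum_list (map f (stake n (sdrop j \<omega>)))\<bar>
    \<le> C * (\<Sum>a\<in>S. \<bar>f a\<bar>)"
proof -
  let ?c = "\<lambda>m a. int (count_list (stake n (sdrop m \<omega>)) a)"
  have eq: "sum_list (map f (stake n (sdrop m \<omega>))) = (\<Sum>a\<in>S. ?c m a * f a)" for m
    using factors_subset_lists[OF S(2), of n] S(1)
    by (intro sum_list_map_eq_sum_count_list) (auto simp: factors_def)
  have "\<bar>(\<Sum>a\<in>S. ?c i a * f a) - (\<Sum>a\<in>S. ?c j a * f a)\<bar> = \<bar>\<Sum>a\<in>S. (?c i a - ?c j a) * f a\<bar>"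
    by (simp add: sum_subtractf left_diff_distrib)
  also have "\<dots> \<le> (\<Sum>a\<in>S. \<bar>(?c i a - ?c j a) * f a\<bar>)" by (rule sum_abs)
  also have "\<dots> \<le> (\<Sum>a\<in>S. C * \<bar>f a\<bar>)"
    using bal by (intro sum_mono) (simp add: abs_mult balanced_def mult_right_mono)
  finally show ?thesis by (simp add: eq sum_distrib_left)
qed

section \<open>Additive complexity of morphic images\<close>

lemma bounded_additive_complexity_if_diff_le:
  assumes diff: "\<And>n i j. \<bar>sum_list (stake n (sdrop i \<omega>)) - sum_list (stake n (sdrop j \<omega>))\<bar> \<le> K"
  shows "bounded_additive_complexity \<omega>"
proof -
  have "finite (sum_list ` factors n \<omega>) \<and> card (sum_list ` factors n \<omega>) \<le> nat (2 * K + 1)" for n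
  proof -
    define s where "s = sum_list (stake n (sdrop 0 \<omega>))"
    have "s - K \<le> sum_list (stake n (sdrop m \<omega>)) \<and> sum_list (stake n (sdrop m \<omega>)) \<le> s + K" for m
      using diff[of n m 0] unfolding s_def by linarith
    then have "sum_list ` factors n \<omega> \<subseteq> {s - K..s + K}"
      by (auto simp: factors_def)
    then have "finite (sum_list ` factors n \<omega>)"
        "card (sum_list ` factors n \<omega>) \<le> card {s - K..s + K}"
      using finite_subset[of _ "{s - K..s + K}"] card_mono[of "{s - K..s + K}"] by auto
    then show ?thesis by simp
  qed
  then show ?thesis unfolding bounded_additive_complexity_def
    by (intro exI[of _ "max 1 (nat (2 * K + 1))"]) (simp add: le_max_iff_disj)
qed

text \<open>
  In the application, \<open>P k\<close> is the length of the image of the prefix of length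
  \<open>k\<close>, and \<open>Q t\<close> is the sum of the first \<open>t\<close> letters of the image word.
\<close>

lemma subsampled_increments_diff_le:
  fixes P :: "nat \<Rightarrow> nat" and Q :: "nat \<Rightarrow> int"
  assumes P0: "P 0 = 0" and mono: "strict_mono P"
    and PL: "\<And>k. P (Suc k) \<le> P k + L"
    and B: "B \<ge> 0" and lip: "\<And>s t. \<bar>Q s - Q t\<bar> \<le> B * \<bar>int s - int t\<bar>"
    and C: "\<And>n i j. \<bar>(int (P (i + n)) - int (P i)) - (int (P (j + n)) - int (P j))\<bar> \<le> C"
    and D: "\<And>n i j. \<bar>(Q (P (i + n)) - Q (P i)) - (Q (P (j + n)) - Q (P j))\<bar> \<le> D"
  shows "\<bar>(Q (i + n) - Q i) - (Q (j + n) - Q j)\<bar> \<le> D + B * (C + 8 * int L)"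
proof -
  \<comment> \<open>Every position \<open>m\<close> lies in the block between two consecutive cut
    points \<open>P k\<close> and \<open>P (Suc k)\<close>.\<close>
  have "\<exists>k. P k \<le> m \<and> m < P (Suc k)" for m
  proof -
    have ex: "\<exists>k. m < P k"
      using strict_mono_imp_increasing[OF mono, of "Suc m"] by (intro exI[of _ "Suc m"]) simp
    define k where "k = (LEAST k. m < P k)"
    have k: "m < P k" "\<And>l. l < k \<Longrightarrow> \<not> m < P l"
      unfolding k_def by (rule LeastI_ex[OF ex]) (rule not_less_Least)
    show ?thesis
    proof (cases k)
      case 0
      then show ?thesis using k(1) P0 by simp
    next
      case (Suc l)
      then show ?thesis using k(1) k(2)[of l] by (intro exI[of _ l]) simp
    qed
  qed
  then obtain k where k: "\<And>m. P (k m) \<le> m" "\<And>m. m < P (Suc (k m))" by metis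
  have near: "\<bar>int (P (k m)) - int m\<bar> \<le> int L" for m
    using k[of m] PL[of "k m"] by linarith
  have Qnear: "\<bar>Q (P (k m)) - Q m\<bar> \<le> B * int L" for m
    using lip[of "P (k m)" m] mult_left_mono[OF near B, of m] by linarith
  have kmono: "k m \<le> k m'" if "m \<le> m'" for m m'
  proof (rule ccontr)
    assume "\<not> k m \<le> k m'"
    then have "P (Suc (k m')) \<le> P (k m)" using mono by (simp add: strict_mono_less_eq)
    then show False using k[of m] k[of m'] that by linarith
  qed
  \<comment> \<open>\<open>d\<close> counts the blocks between the cut points below \<open>i\<close>
    and \<open>i + n\<close>. The same number of blocks is taken from \<open>k j\<close>, since
    \<open>C\<close> and \<open>D\<close> compare equally many blocks; \<open>k j + d\<close> may
    differ from \<open>k (j + n)\<close>.\<close>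
  define d where "d = k (i + n) - k i"
  have d: "k (i + n) = k i + d" using kmono[of i "i + n"] by (simp add: d_def)
  \<comment> \<open>Each of the four positions \<open>i\<close>, \<open>i + n\<close>,
    \<open>j\<close>, \<open>j + n\<close> is within \<open>L\<close> of its cut point, which gives
    \<open>4 * int L\<close>.\<close>
  have "\<bar>int (P (k (j + n))) - int (P (k j + d))\<bar> \<le> C + 4 * int L"
    using near[of i] near[of "i + n"] near[of j] near[of "j + n"] C[of "k i" d "k j"]
    unfolding d abs_le_iff by linarith
  from lip[of "P (k (j + n))" "P (k j + d)"] mult_left_mono[OF this B]
  have "\<bar>Q (P (k (j + n))) - Q (P (k j + d))\<bar> \<le> B * C + 4 * (B * int L)"
    by (simp add: algebra_simps)
  moreover note D[of "k i" d "k j"] Qnear[of i] Qnear[of "i + n"] Qnear[of j] Qnear[of "j + n"]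
  \<comment> \<open>Four of the eight terms \<open>B * int L\<close> come from replacing
    \<open>k (j + n)\<close> by \<open>k j + d\<close>, the others from the four uses of
    \<open>Qnear\<close>.\<close>
  ultimately have "\<bar>(Q (i + n) - Q i) - (Q (j + n) - Q j)\<bar> \<le> D + B * C + 8 * (B * int L)"
    unfolding d abs_le_iff by linarith
  then show ?thesis by (simp add: algebra_simps)
qed

text \<open>Cuts the image word after the image of a prefix, so that \<open>Q (P k)\<close> becomes
  an additive weight of the prefix of length \<open>k\<close>.\<close>

lemma flat_smap_sdrop:
  assumes ne: "\<forall>x\<in>sset \<omega>. g x \<noteq> []"
  shows "flat (smap g \<omega>) = concat (map g (stake k \<omega>)) @- flat (smap g (sdrop k \<omega>))"
proof (induction k)
  case (Suc k)
  have "shd (sdrop k \<omega>) \<in> sset \<omega>"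
    using snth_sset[of \<omega> k] by simp
  then have "flat (smap g (sdrop k \<omega>)) = g (\<omega> !! k) @- flat (smap g (sdrop (Suc k) \<omega>))"
    using ne by (subst flat_unfold) auto
  from Suc[unfolded this] show ?case
    by (simp add: stake_Suc del: stake.simps sdrop.simps)
qed simp

lemma sum_list_concat_map:
  "sum_list (concat (map g xs)) = (\<Sum>x\<leftarrow>xs. sum_list (g x))"
  by (induction xs) simp_all

lemma flat_smap_singleton: "flat (smap (\<lambda>x. [f x]) s) = smap f s"
proof -
  have unfold: "flat (smap (\<lambda>x. [f x]) s) = f (shd s) ## flat (smap (\<lambda>x. [f x]) (stl s))" for s
    by (subst flat_unfold) simp_all
  have "flat (smap (\<lambda>x. [f x]) s) !! n = smap f s !! n" for n
    by (induction n arbitrary: s) (subst unfold, simp)+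
  then have "snth (flat (smap (\<lambda>x. [f x]) s)) = snth (smap f s)"
    by (rule ext)
  then show ?thesis by (metis stream_smap_nats)
qed

lemma sum_list_stake_lipschitz:
  fixes \<omega> :: "int stream"
  assumes "\<And>x. x \<in> sset \<omega> \<Longrightarrow> \<bar>x\<bar> \<le> B"
  shows "\<bar>sum_list (stake s \<omega>) - sum_list (stake t \<omega>)\<bar> \<le> B * \<bar>int s - int t\<bar>"
proof -
  have up: "\<bar>sum_list (stake (s + d) \<omega>) - sum_list (stake s \<omega>)\<bar> \<le> B * int d" for s d
  proof (induction d)
    case (Suc d)
    have "\<bar>\<omega> !! (s + d)\<bar> \<le> B" using assms snth_sset by blast
    then show ?case using Suc by (simp add: stake_Suc algebra_simps del: stake.simps)
  qed simp
  show ?thesis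
  proof (cases "s \<le> t")
    case True
    then show ?thesis using up[of s "t - s"] by (simp add: abs_minus_commute of_nat_diff)
  next
    case False
    then show ?thesis using up[of t "s - t"] by (simp add: of_nat_diff)
  qed
qed

text \<open>Length and sum of the image are both additive weights of the letters, so
  \<open>balanced_weight_diff_le\<close> yields both constants for
  \<open>subsampled_increments_diff_le\<close>.\<close>

lemma balanced_imp_image_bounded_additive_complexity:
  fixes g :: "'a \<Rightarrow> int list"
  assumes S: "finite S" "\<omega> \<in> streams S" and bal: "balanced C \<omega>"
    and g: "\<And>x. x \<in> S \<Longrightarrow> g x \<noteq> []"
  shows "bounded_additive_complexity (flat (smap g \<omega>))"
proof -
  let ?\<omega>' = "flat (smap g \<omega>)"
  define P where "P k = length (concat (map g (stake k \<omega>)))" for k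
  define Q where "Q j = sum_list (stake j ?\<omega>')" for j
  \<comment> \<open>In both maxima \<open>insert 0\<close> keeps the set nonempty; it also makes
    \<open>B\<close> nonnegative.\<close>
  define L where "L = Max (insert 0 ((\<lambda>x. length (g x)) ` S))"
  define B where "B = Max (insert 0 (abs ` (\<Union>x\<in>S. set (g x))))"
  have sS: "sset \<omega> \<subseteq> S" using S by (simp add: streams_iff_sset)
  then have ne: "\<forall>x\<in>sset \<omega>. g x \<noteq> []" using g by auto
  have L: "length (g x) \<le> L" if "x \<in> S" for x
    using that S unfolding L_def by (intro Max_ge) auto
  have fin: "finite (insert 0 (abs ` (\<Union>x\<in>S. set (g x))))" using S by simp
  have B0: "B \<ge> 0" unfolding B_def by (rule Max_ge[OF fin]) simp
  have B: "\<bar>y\<bar> \<le> B" if "y \<in> sset ?\<omega>'" for y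
    using that ne sS unfolding B_def by (intro Max_ge[OF fin]) (auto simp: stream.set_map)
  have Q_P: "Q (P k) = sum_list (map (\<lambda>x. sum_list (g x)) (stake k \<omega>))" for k
    unfolding Q_def P_def
    by (subst flat_smap_sdrop[OF ne, of k]) (simp add: stake_shift sum_list_concat_map)
  have P_eq: "int (P k) = sum_list (map (\<lambda>x. int (length (g x))) (stake k \<omega>))" for k
    by (simp add: P_def length_concat comp_def flip: sum_list_of_nat)
  have P_Suc: "P (Suc k) = P k + length (g (\<omega> !! k))" for k
    by (simp add: P_def stake_Suc del: stake.simps)
  have "\<bar>(Q (i + n) - Q i) - (Q (j + n) - Q j)\<bar> \<le>
      C * (\<Sum>a\<in>S. \<bar>sum_list (g a)\<bar>) +
      B * (C * (\<Sum>a\<in>S. \<bar>int (length (g a))\<bar>) + 8 * int L)" for i j n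
  proof (rule subsampled_increments_diff_le[where P = P])
    show "P 0 = 0" by (simp add: P_def)
    show "strict_mono P" using ne snth_sset by (fastforce simp: strict_mono_Suc_iff P_Suc)
    show "P (Suc k) \<le> P k + L" for k using L sS snth_sset by (fastforce simp: P_Suc)
    show "\<bar>Q s - Q t\<bar> \<le> B * \<bar>int s - int t\<bar>" for s t
      unfolding Q_def by (rule sum_list_stake_lipschitz[OF B])
    show "\<bar>(int (P (i + n)) - int (P i)) - (int (P (j + n)) - int (P j))\<bar>
        \<le> C * (\<Sum>a\<in>S. \<bar>int (length (g a))\<bar>)" for n i j
      using balanced_weight_diff_le[OF S bal, where f = "\<lambda>x. int (length (g x))"]
      unfolding P_eq sum_list_factor .
    show "\<bar>(Q (P (i + n)) - Q (P i)) - (Q (P (j + n)) - Q (P j))\<bar>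
        \<le> C * (\<Sum>a\<in>S. \<bar>sum_list (g a)\<bar>)" for n i j
      using balanced_weight_diff_le[OF S bal, where f = "\<lambda>x. sum_list (g x)"]
      unfolding Q_P sum_list_factor .
  qed (rule B0)
  then show ?thesis
    using sum_list_factor[of "\<lambda>x. x" _ _ ?\<omega>']
    by (intro bounded_additive_complexity_if_diff_le) (simp add: Q_def)
qed

section \<open>Balancedness from 0-1 codings\<close>

lemma letter_coding_sums:
  "sum_list ` factors n (smap (\<lambda>x. if x = a then 1 else 0 :: int) \<omega>) =
    (\<lambda>u. int (count_list u a)) ` factors n \<omega>"
proof -
  have "sum_list (map (\<lambda>x. if x = a then 1 else 0 :: int) u) = int (count_list u a)" for u
    by (induction u) auto
  then show ?thesis by (simp add: factors_eq_range image_image)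
qed

text \<open>Each letter \<open>a\<close> is isolated by its own coding into \<open>{0, 1}\<close>.
  The resulting bounds depend on \<open>a\<close> and are merged by summing over the finite
  alphabet.\<close>

lemma balanced_if_all_anchor:
  fixes \<omega> :: "int stream"
  assumes S: "finite S" "\<omega> \<in> streams S"
    and anch: "\<And>\<phi>. morphism S {0, 1} \<phi> \<Longrightarrow> non_erasing S \<phi> \<Longrightarrow> anchors {0, 1} \<phi> \<omega>"
  obtains C where "balanced C \<omega>"
proof -
  have "\<exists>M. \<forall>n i j. \<bar>int (count_list (stake n (sdrop i \<omega>)) a)
      - int (count_list (stake n (sdrop j \<omega>)) a)\<bar> \<le> int M" for a
  proof -
    define c where "c = (\<lambda>x. if x = a then 1 else 0 :: int)"
    have "[c x] \<in> lists {0, 1} \<and> [c x] \<noteq> []" for x by (simp add: c_def)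
    from morphism_exists[of S "\<lambda>x. [c x]", OF this] obtain \<phi> where \<phi>: "morphism S {0, 1} \<phi>" "non_erasing S \<phi>"
      "\<And>x. x \<in> S \<Longrightarrow> \<phi> (FinW [x]) = FinW [c x]"
      by blast
    have "\<phi> (InfW \<omega>) = InfW (smap c \<omega>)"
      using morphism_InfW[OF \<phi>(1,2) S(2) \<phi>(3)] by (simp add: flat_smap_singleton)
    then have "bounded_additive_complexity (smap c \<omega>)"
      using anch[OF \<phi>(1,2)] by (simp add: anchors_def)
    then obtain M where M: "\<And>n. n \<ge> 1 \<Longrightarrow> finite ((\<lambda>u. int (count_list u a)) ` factors n \<omega>) \<and>
        card ((\<lambda>u. int (count_list u a)) ` factors n \<omega>) \<le> M"
      unfolding bounded_additive_complexity_def c_def letter_coding_sums by blast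
    show ?thesis
      by (intro exI[of _ M] allI count_diff_le_if_card_count_le) (rule M)
  qed
  then obtain M where M: "\<And>a n i j. \<bar>int (count_list (stake n (sdrop i \<omega>)) a)
      - int (count_list (stake n (sdrop j \<omega>)) a)\<bar> \<le> int (M a)"
    by metis
  have "balanced (int (\<Sum>a\<in>S. M a)) \<omega>"
    unfolding balanced_def
  proof (intro allI)
    fix a n i j
    show "\<bar>int (count_list (stake n (sdrop i \<omega>)) a) - int (count_list (stake n (sdrop j \<omega>)) a)\<bar>
        \<le> int (\<Sum>a\<in>S. M a)"
    proof (cases "a \<in> S")
      case True
      then have "M a \<le> (\<Sum>a\<in>S. M a)" using S(1) by (simp add: member_le_sum)
      then show ?thesis using M[of n i a j] by linarith
    next
      case False
      \<comment> \<open>The sum bounds \<open>M a\<close> only for \<open>a\<close> in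
        \<open>S\<close>; other letters never occur.\<close>
      have "count_list (stake n (sdrop m \<omega>)) a = 0" for m
        using factors_subset_lists[OF S(2), of n] False by (auto simp: factors_def count_list_0_iff)
      then show ?thesis by (simp add: sum_nonneg)
    qed
  qed
  then show ?thesis by (rule that)
qed

theorem theorem3p2:
  fixes S :: "int set" and \<omega> :: "int stream"
  assumes "finite S" and "\<omega> \<in> streams S"
  shows "bounded_abelian_complexity \<omega> \<longleftrightarrow>
    (\<forall>T :: int set. finite T \<longrightarrow>
      (\<forall>\<phi>. morphism S T \<phi> \<and> non_erasing S \<phi> \<longrightarrow> anchors T \<phi> \<omega>))"
proof
  assume "bounded_abelian_complexity \<omega>"
  then obtain C where bal: "balanced C \<omega>"
    using bounded_abelian_complexity_imp_balanced assms by blast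
  show "\<forall>T :: int set. finite T \<longrightarrow>
      (\<forall>\<phi>. morphism S T \<phi> \<and> non_erasing S \<phi> \<longrightarrow> anchors T \<phi> \<omega>)"
  proof (intro allI impI, elim conjE)
    fix T :: "int set" and \<phi>
    assume mor: "morphism S T \<phi>" and ne: "non_erasing S \<phi>"
    have "\<exists>u. \<phi> (FinW [x]) = FinW u \<and> u \<noteq> []" if "x \<in> S" for x
    proof -
      have "[x] \<in> lists S" using that by simp
      then have "\<phi> (FinW [x]) \<in> FinW ` lists T" using mor unfolding morphism_def by blast
      moreover have "\<phi> (FinW [x]) \<noteq> FinW []"
        using ne \<open>[x] \<in> lists S\<close> unfolding non_erasing_def ext_words_def by blast
      ultimately show ?thesis by auto
    qed
    then obtain g where g: "\<And>x. x \<in> S \<Longrightarrow> \<phi> (FinW [x]) = FinW (g x)"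
      "\<And>x. x \<in> S \<Longrightarrow> g x \<noteq> []" by metis
    have eq: "\<phi> (InfW \<omega>) = InfW (flat (smap g \<omega>))"
      using morphism_InfW[OF mor ne assms(2) g(1)] .
    have "InfW \<omega> \<in> ext_words S" using assms(2) by (simp add: ext_words_def)
    then have "\<phi> (InfW \<omega>) \<in> ext_words T" using mor unfolding morphism_def by blast
    then have "flat (smap g \<omega>) \<in> streams T" by (auto simp: eq ext_words_def)
    then show "anchors T \<phi> \<omega>"
      using balanced_imp_image_bounded_additive_complexity[OF assms bal, of g] g(2) eq
      unfolding anchors_def by blast
  qed
next
  assume anch: "\<forall>T :: int set. finite T \<longrightarrow>
      (\<forall>\<phi>. morphism S T \<phi> \<and> non_erasing S \<phi> \<longrightarrow> anchors T \<phi> \<omega>)"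
  obtain C where "balanced C \<omega>"
    using balanced_if_all_anchor[OF assms] anch by (metis finite.emptyI finite.insertI)
  then show "bounded_abelian_complexity \<omega>"
    by (rule balanced_imp_bounded_abelian_complexity[OF assms])
qed

end
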